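(* Let $(\mathfrak{g}_T,[\,,\,]_{\mathfrak{g}})$ be a Rota-Baxter Leibniz algebra, let $V$ be a vector space and $T_V:V\to V$ a linear map, and regard $(V_{T_V},\mu)$ as a Rota-Baxter Leibniz algebra with the bracket $\mu(u,v)=0$ for all $u,v\in V$. Then two isomorphic abelian extensions of $(\mathfrak{g}_T,[\,,\,]_{\mathfrak{g}})$ by $(V_{T_V},\mu)$ give rise to the same element in $H^2_{RBLA}(\mathfrak{g},V)$; that is, the classes $[(\psi_1,\chi_1)]$ and $[(\psi_2,\chi_2)]$ associated with the two extensions coincide.
   Context: All vector spaces are over a fixed field. A (left) Leibniz algebra is a vector space $\mathfrak{g}$ with a bilinear bracket satisfying $[x,[y,z]_{\mathfrak{g}}]_{\mathfrak{g}}=[[x,y]_{\mathfrak{g}},z]_{\mathfrak{g}}+[y,[x,z]_{\mathfrak{g}}]_{\mathfrak{g}}$. A Rota-Baxter operator is a linear map $T:\mathfrak{g}\to\mathfrak{g}$ with $[T(x),T(y)]_{\mathfrak{g}}=T([T(x),y]_{\mathfrak{g}}+[x,T(y)]_{\mathfrak{g}})$. A Rota-Baxter Leibniz algebra $(\mathfrak{g}_T,[\,,\,]_{\mathfrak{g}})$ is a Leibniz algebra together with a Rota-Baxter operator $T$. A morphism of Rota-Baxter Leibniz algebras $\mathfrak{g}_T\to\mathfrak{g}'_{T'}$ is a Leibniz algebra homomorphism $\varphi$ with $T'\circ\varphi=\varphi\circ T$; it is an isomorphism if it is a linear isomorphism. An abelian extension of $(\mathfrak{g}_T,[\,,\,]_{\mathfrak{g}})$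 by $(V_{T_V},\mu)$ ($\mu=0$) is a short exact sequence of morphisms of Rota-Baxter Leibniz algebras $0\to(V_{T_V},\mu)\xrightarrow{i}(\hat{\mathfrak{g}}_{\hat T},[\,,\,]_\wedge)\xrightarrow{p}(\mathfrak{g}_T,[\,,\,]_{\mathfrak{g}})\to0$; $V$ is identified with $i(V)$. Two abelian extensions, with middle terms $(\hat{\mathfrak{g}}_{\hat T_1},[\,,\,]_{\wedge_1})$ (maps $i_1,p_1$) and $(\hat{\mathfrak{g}}_{\hat T_2},[\,,\,]_{\wedge_2})$ (maps $i_2,p_2$), are isomorphic if there is an isomorphism $\xi$ of Rota-Baxter Leibniz algebras from the first middle term to the second with $\xi\circ i_1=i_2$ and $p_2\circ\xi=p_1$. A section is a linear map $s:\mathfrak{g}\to\hat{\mathfrak{g}}$ with $p\circ s=\mathrm{Id}_{\mathfrak{g}}$. Given an abelian extension with section $s$, $V$ is a representation $(V,l_V,r_V,T_V)$ of $(\mathfrak{g}_T,[\,,\,]_{\mathfrak{g}})$ via $l_V(x,u)=[s(x),u]_\wedge$, $r_V(u,x)=[u,s(x)]_\wedge$ (independent of $s$, and the same for isomorphic extensions). Define $\psi:\mathfrak{g}\otimes\mathfrak{g}\to V$ and $\chi:\mathfrak{g}\to V$ by $\psi(x\otimes y)=[s(x),s(y)]_\wedge-s([x,y]_{\mathfrak{g}})$ and $\chi(x)=\hat T(s(x))-s(T(x))$. The element of $H^2_{RBLA}(\mathfrak{g},V)$ associated with the extension is the class of $(\psi,\chi)$, which does not depend on $s$. Cohomology. Put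 $C^n_{LA}(\mathfrak{g},V)=C^n_{RBO}(\mathfrak{g},V)=\mathrm{Hom}(\mathfrak{g}^{\otimes n},V)$, $n\ge0$. Define $\delta^n:C^n_{LA}(\mathfrak{g},V)\to C^{n+1}_{LA}(\mathfrak{g},V)$ by $$\begin{aligned}(\delta^n f)(x_1,\dots,x_{n+1})=&\sum_{i=1}^{n}(-1)^{i+1}l_V(x_i,f(x_1,\dots,\widehat{x_i},\dots,x_{n+1}))+(-1)^{n+1}r_V(f(x_1,\dots,x_n),x_{n+1})\\&+\sum_{1\le i<j\le n+1}(-1)^i f(x_1,\dots,\widehat{x_i},\dots,x_{j-1},[x_i,x_j]_{\mathfrak{g}},x_{j+1},\dots,x_{n+1}).\end{aligned}$$ Define $\partial^n:C^n_{RBO}(\mathfrak{g},V)\to C^{n+1}_{RBO}(\mathfrak{g},V)$ by the same formula with $l_V,r_V,[\,,\,]_{\mathfrak{g}}$ replaced by $l'_V(x,u)=l_V(T(x),u)-T_V(l_V(x,u))$, $r'_V(u,x)=r_V(u,T(x))-T_V(r_V(u,x))$, $[x,y]_*=[x,T(y)]_{\mathfrak{g}}+[T(x),y]_{\mathfrak{g}}$. Define $\phi^n(f)(x_1,\dots,x_n)=f(Tx_1,\dots,Tx_n)-\sum_{i=1}^n T_V(f(Tx_1,\dots,Tx_{i-1},x_i,Tx_{i+1},\dots,Tx_n))$. For $n\ge1$, $C^n_{RBLA}(\mathfrak{g},V)=C^n_{LA}(\mathfrak{g},V)\oplus C^{n-1}_{RBO}(\mathfrak{g},V)$, $d^n(\alpha,\beta)=(\delta^n(\alpha),-\partial^{n-1}(\beta)-\phi^n(\alpha))$,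 and $H^2_{RBLA}(\mathfrak{g},V)=\ker d^2/\operatorname{im}d^1$. *)

theory Defs
  imports
    Complex_Main
    "HOL-Library.Function_Algebras"
    "HOL-Library.Product_Plus"
    "HOL-Library.Set_Algebras"
begin

locale leibniz_algebra = vector_space scale
  for scale :: "'k::field \<Rightarrow> 'a::ab_group_add \<Rightarrow> 'a" +
  fixes bracket :: "'a \<Rightarrow> 'a \<Rightarrow> 'a"
  assumes bracket_linear_right: "Vector_Spaces.linear scale scale (\<lambda>y. bracket x y)"
    and bracket_linear_left: "Vector_Spaces.linear scale scale (\<lambda>x. bracket x y)"
    and leibniz: "bracket x (bracket y z) = bracket (bracket x y) z + bracket y (bracket x z)"

locale rb_leibniz_algebra = leibniz_algebra scale bracket
  for scale :: "'k::field \<Rightarrow> 'a::ab_group_add \<Rightarrow> 'a" and bracket :: "'a \<Rightarrow> 'a \<Rightarrow> 'a" +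
  fixes T :: "'a \<Rightarrow> 'a"
  assumes T_linear: "Vector_Spaces.linear scale scale T"
    and rota_baxter: "bracket (T x) (T y) = T (bracket (T x) y + bracket x (T y))"

locale rb_leibniz_hom =
  dom: rb_leibniz_algebra scale1 bracket1 T1 + cod: rb_leibniz_algebra scale2 bracket2 T2
  for scale1 :: "'k::field \<Rightarrow> 'a::ab_group_add \<Rightarrow> 'a" and bracket1 T1
    and scale2 :: "'k \<Rightarrow> 'b::ab_group_add \<Rightarrow> 'b" and bracket2 T2 +
  fixes f :: "'a \<Rightarrow> 'b"
  assumes hom_linear: "Vector_Spaces.linear scale1 scale2 f"
    and hom_bracket: "f (bracket1 x y) = bracket2 (f x) (f y)"
    and hom_T: "T2 \<circ> f = f \<circ> T1"

definition rb_leibniz_iso where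
  "rb_leibniz_iso scale1 bracket1 T1 scale2 bracket2 T2 f \<longleftrightarrow>
     rb_leibniz_hom scale1 bracket1 T1 scale2 bracket2 T2 f \<and> bij f"

locale abelian_extension =
  incl: rb_leibniz_hom scaleV "\<lambda>_ _. 0" TV scaleE bracketE TE i +
  proj: rb_leibniz_hom scaleE bracketE TE scaleG bracketG TG p
  for scaleG :: "'k::field \<Rightarrow> 'g::ab_group_add \<Rightarrow> 'g" and bracketG TG
    and scaleV :: "'k \<Rightarrow> 'v::ab_group_add \<Rightarrow> 'v" and TV
    and scaleE :: "'k \<Rightarrow> 'e::ab_group_add \<Rightarrow> 'e" and bracketE TE i p +
  assumes exact_left: "inj i"
    and exact_middle: "range i = {e. p e = 0}"
    and exact_right: "surj p"

definition isomorphic_extensions where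
  "isomorphic_extensions scale1 bracket1 T1 i1 p1 scale2 bracket2 T2 i2 p2 \<longleftrightarrow>
     (\<exists>\<xi>. rb_leibniz_iso scale1 bracket1 T1 scale2 bracket2 T2 \<xi> \<and> \<xi> \<circ> i1 = i2 \<and> p2 \<circ> \<xi> = p1)"

definition is_section where
  "is_section scaleG scaleE p s \<longleftrightarrow> Vector_Spaces.linear scaleG scaleE s \<and> p \<circ> s = id"

text \<open>
  The identification of \<open>V\<close> with \<open>i(V)\<close> is made explicit: an element of \<open>i(V)\<close> is
  transported back to \<open>V\<close> by \<open>inv i\<close>, which is a genuine inverse there as \<open>i\<close> is injective.
\<close>

definition ext_l :: "('v \<Rightarrow> 'e) \<Rightarrow> ('e \<Rightarrow> 'e \<Rightarrow> 'e) \<Rightarrow> ('g \<Rightarrow> 'e) \<Rightarrow> 'g \<Rightarrow> 'v \<Rightarrow> 'v" where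
  "ext_l i bracketE s x u = inv i (bracketE (s x) (i u))"

definition ext_r :: "('v \<Rightarrow> 'e) \<Rightarrow> ('e \<Rightarrow> 'e \<Rightarrow> 'e) \<Rightarrow> ('g \<Rightarrow> 'e) \<Rightarrow> 'v \<Rightarrow> 'g \<Rightarrow> 'v" where
  "ext_r i bracketE s u x = inv i (bracketE (i u) (s x))"

text \<open>
  \<open>Hom(g\<^sup>\<otimes>\<^sup>n, V)\<close> is represented by the \<open>n\<close>-linear maps on lists of length \<open>n\<close>,
  with value \<open>0\<close> on lists of any other length, so that equality of cochains is equality
  of functions. For \<open>n = 0\<close> this is a copy of \<open>V\<close>.
\<close>

definition cochains ::
  "('k::field \<Rightarrow> 'g::ab_group_add \<Rightarrow> 'g) \<Rightarrow> ('k \<Rightarrow> 'v::ab_group_add \<Rightarrow> 'v) \<Rightarrow> nat \<Rightarrow> ('g list \<Rightarrow> 'v) set"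
where
  "cochains scaleG scaleV n =
     {f. (\<forall>xs. length xs \<noteq> n \<longrightarrow> f xs = 0) \<and>
         (\<forall>xs j. length xs = n \<and> j < n \<longrightarrow>
            Vector_Spaces.linear scaleG scaleV (\<lambda>x. f (xs[j := x])))}"

definition omit :: "nat \<Rightarrow> 'a list \<Rightarrow> 'a list" where
  "omit i xs = take i xs @ drop (Suc i) xs"

text \<open>
  List positions start at \<open>0\<close>, so the argument \<open>x\<^sub>i\<close> of the usual formula is
  \<open>xs ! (i - 1)\<close>, and the signs \<open>(-1)\<^sup>i\<^sup>+\<^sup>1\<close> and \<open>(-1)\<^sup>i\<close> of the two sums become
  \<open>(-1)\<^sup>i\<close> and \<open>(-1)\<^sup>i\<^sup>+\<^sup>1\<close>.
\<close>

definition leibniz_coboundary ::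
  "('k::field \<Rightarrow> 'v::ab_group_add \<Rightarrow> 'v) \<Rightarrow> ('g \<Rightarrow> 'g \<Rightarrow> 'g) \<Rightarrow> ('g \<Rightarrow> 'v \<Rightarrow> 'v) \<Rightarrow> ('v \<Rightarrow> 'g \<Rightarrow> 'v) \<Rightarrow>
     nat \<Rightarrow> ('g list \<Rightarrow> 'v) \<Rightarrow> 'g list \<Rightarrow> 'v"
where
  "leibniz_coboundary scaleV bracket l r n f xs =
     (if length xs = Suc n then
        (\<Sum>i<n. scaleV ((- 1) ^ i) (l (xs ! i) (f (omit i xs))))
        + scaleV ((- 1) ^ Suc n) (r (f (take n xs)) (xs ! n))
        + (\<Sum>j\<le>n. \<Sum>i<j.
             scaleV ((- 1) ^ Suc i) (f (omit i (xs[j := bracket (xs ! i) (xs ! j)]))))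
      else 0)"

definition bracket_star :: "('g \<Rightarrow> 'g \<Rightarrow> 'g) \<Rightarrow> ('g \<Rightarrow> 'g) \<Rightarrow> 'g \<Rightarrow> 'g \<Rightarrow> 'g::ab_group_add" where
  "bracket_star bracket T x y = bracket x (T y) + bracket (T x) y"

definition l_prime ::
  "('g \<Rightarrow> 'g) \<Rightarrow> ('v \<Rightarrow> 'v) \<Rightarrow> ('g \<Rightarrow> 'v \<Rightarrow> 'v) \<Rightarrow> 'g \<Rightarrow> 'v \<Rightarrow> 'v::ab_group_add" where
  "l_prime T TV l x u = l (T x) u - TV (l x u)"

definition r_prime ::
  "('g \<Rightarrow> 'g) \<Rightarrow> ('v \<Rightarrow> 'v) \<Rightarrow> ('v \<Rightarrow> 'g \<Rightarrow> 'v) \<Rightarrow> 'v \<Rightarrow> 'g \<Rightarrow> 'v::ab_group_add" where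
  "r_prime T TV r u x = r u (T x) - TV (r u x)"

definition rbo_coboundary ::
  "('k::field \<Rightarrow> 'v::ab_group_add \<Rightarrow> 'v) \<Rightarrow> ('g::ab_group_add \<Rightarrow> 'g \<Rightarrow> 'g) \<Rightarrow> ('g \<Rightarrow> 'g) \<Rightarrow> ('v \<Rightarrow> 'v) \<Rightarrow>
     ('g \<Rightarrow> 'v \<Rightarrow> 'v) \<Rightarrow> ('v \<Rightarrow> 'g \<Rightarrow> 'v) \<Rightarrow> nat \<Rightarrow> ('g list \<Rightarrow> 'v) \<Rightarrow> 'g list \<Rightarrow> 'v"
where
  "rbo_coboundary scaleV bracket T TV l r =
     leibniz_coboundary scaleV (bracket_star bracket T) (l_prime T TV l) (r_prime T TV r)"

definition phi ::
  "('g \<Rightarrow> 'g) \<Rightarrow> ('v \<Rightarrow> 'v) \<Rightarrow> nat \<Rightarrow> ('g list \<Rightarrow> 'v) \<Rightarrow> 'g list \<Rightarrow> 'v::ab_group_add"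
where
  "phi T TV n f xs =
     (if length xs = n then
        f (map T xs) - (\<Sum>i<n. TV (f ((map T xs)[i := xs ! i])))
      else 0)"

text \<open>The complex starts in degree \<open>1\<close>; the definitions below are meaningful for \<open>n \<ge> 1\<close>.\<close>

definition rbla_cochains where
  "rbla_cochains scaleG scaleV n = cochains scaleG scaleV n \<times> cochains scaleG scaleV (n - 1)"

definition rbla_d ::
  "('k::field \<Rightarrow> 'v::ab_group_add \<Rightarrow> 'v) \<Rightarrow> ('g::ab_group_add \<Rightarrow> 'g \<Rightarrow> 'g) \<Rightarrow> ('g \<Rightarrow> 'g) \<Rightarrow> ('v \<Rightarrow> 'v) \<Rightarrow>
     ('g \<Rightarrow> 'v \<Rightarrow> 'v) \<Rightarrow> ('v \<Rightarrow> 'g \<Rightarrow> 'v) \<Rightarrow> nat \<Rightarrow>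
     ('g list \<Rightarrow> 'v) \<times> ('g list \<Rightarrow> 'v) \<Rightarrow> ('g list \<Rightarrow> 'v) \<times> ('g list \<Rightarrow> 'v)"
where
  "rbla_d scaleV bracket T TV l r n = (\<lambda>(\<alpha>, \<beta>).
     (leibniz_coboundary scaleV bracket l r n \<alpha>,
      - rbo_coboundary scaleV bracket T TV l r (n - 1) \<beta> - phi T TV n \<alpha>))"

definition Z2_RBLA where
  "Z2_RBLA scaleG bracket T scaleV TV l r =
     {z \<in> rbla_cochains scaleG scaleV 2. rbla_d scaleV bracket T TV l r 2 z = 0}"

definition B2_RBLA where
  "B2_RBLA scaleG bracket T scaleV TV l r =
     rbla_d scaleV bracket T TV l r 1 ` rbla_cochains scaleG scaleV 1"

text \<open>The elements of the quotient are the cosets \<open>z + im d\<^sup>1\<close> with \<open>z \<in> ker d\<^sup>2\<close>.\<close>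

definition class_RBLA where
  "class_RBLA scaleG bracket T scaleV TV l r z = z +o B2_RBLA scaleG bracket T scaleV TV l r"

definition H2_RBLA where
  "H2_RBLA scaleG bracket T scaleV TV l r =
     class_RBLA scaleG bracket T scaleV TV l r ` Z2_RBLA scaleG bracket T scaleV TV l r"

definition ext_psi ::
  "('g \<Rightarrow> 'g \<Rightarrow> 'g) \<Rightarrow> ('v::ab_group_add \<Rightarrow> 'e::ab_group_add) \<Rightarrow> ('e \<Rightarrow> 'e \<Rightarrow> 'e) \<Rightarrow> ('g \<Rightarrow> 'e) \<Rightarrow> 'g list \<Rightarrow> 'v"
where
  "ext_psi bracket i bracketE s xs =
     (if length xs = 2 then
        inv i (bracketE (s (xs ! 0)) (s (xs ! 1)) - s (bracket (xs ! 0) (xs ! 1)))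
      else 0)"

definition ext_chi ::
  "('g \<Rightarrow> 'g) \<Rightarrow> ('v::ab_group_add \<Rightarrow> 'e::ab_group_add) \<Rightarrow> ('e \<Rightarrow> 'e) \<Rightarrow> ('g \<Rightarrow> 'e) \<Rightarrow> 'g list \<Rightarrow> 'v"
where
  "ext_chi T i TE s xs =
     (if length xs = 1 then inv i (TE (s (xs ! 0)) - s (T (xs ! 0))) else 0)"

definition ext_class where
  "ext_class scaleG bracket T scaleV TV bracketE TE i s =
     class_RBLA scaleG bracket T scaleV TV (ext_l i bracketE s) (ext_r i bracketE s)
       (ext_psi bracket i bracketE s, ext_chi T i TE s)"

end

theory Submission
  imports Defs
begin

text \<open>
  A section \<open>s\<close> of the first extension is carried by the isomorphism \<open>\<xi>\<close> to the section
  \<open>\<xi> \<circ> s\<close> of the second one, with the same actions and the same pair \<open>(\<psi>, \<chi>)\<close>. So it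
  suffices to compare two sections \<open>s\<close>, \<open>s'\<close> of a single extension. Their difference is \<open>i \<circ> f\<close>
  with \<open>f : g \<rightarrow> V\<close> linear; the actions agree because the bracket vanishes on \<open>V\<close>, and
  \<open>(\<psi>', \<chi>') - (\<psi>, \<chi>) = d\<^sup>1 (f, 0)\<close>.
\<close>

section \<open>Linear maps and coboundaries in low degree\<close>

lemma linear_addD: "Vector_Spaces.linear s1 s2 f \<Longrightarrow> f (x + y) = f x + f y"
  by (simp add: Vector_Spaces.linear_iff)

lemma linear_scaleD: "Vector_Spaces.linear s1 s2 f \<Longrightarrow> f (s1 c x) = s2 c (f x)"
  by (simp add: Vector_Spaces.linear_iff)

lemma linear_zeroD:
  fixes f :: "'a::ab_group_add \<Rightarrow> 'b::ab_group_add"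
  assumes "Vector_Spaces.linear s1 s2 f"
  shows "f 0 = 0"
  using linear_addD[OF assms, of 0 0] by simp

lemma linear_diffD:
  fixes f :: "'a::ab_group_add \<Rightarrow> 'b::ab_group_add"
  assumes "Vector_Spaces.linear s1 s2 f"
  shows "f (x - y) = f x - f y"
  using linear_addD[OF assms, of "x - y" y] by simp

lemma leibniz_coboundary_1:
  assumes "vector_space scaleV"
  shows "leibniz_coboundary scaleV b l r 1 f xs =
    (if length xs = 2 then l (xs ! 0) (f [xs ! 1]) + r (f [xs ! 0]) (xs ! 1)
       - f [b (xs ! 0) (xs ! 1)] else 0)"
proof -
  interpret V: vector_space scaleV by fact
  show ?thesis
  proof (cases "length xs = 2")
    case True
    then obtain x y where "xs = [x, y]"
      by (auto simp: numeral_2_eq_2 length_Suc_conv)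
    then show ?thesis
      by (simp add: leibniz_coboundary_def omit_def atMost_Suc lessThan_Suc)
  qed (simp add: leibniz_coboundary_def)
qed

lemma leibniz_coboundary_2:
  assumes "vector_space scaleV"
  shows "leibniz_coboundary scaleV b l r 2 f [x, y, z] =
    l x (f [y, z]) - l y (f [x, z]) - r (f [x, y]) z
      - f [b x y, z] - f [y, b x z] + f [x, b y z]"
proof -
  interpret V: vector_space scaleV by fact
  show ?thesis
    by (simp add: leibniz_coboundary_def omit_def atMost_Suc lessThan_Suc numeral_2_eq_2)
qed

lemma cochains_1_iff:
  "f \<in> cochains scaleG scaleV 1 \<longleftrightarrow>
     (\<forall>xs. length xs \<noteq> 1 \<longrightarrow> f xs = 0) \<and> Vector_Spaces.linear scaleG scaleV (\<lambda>x. f [x])"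
  by (auto simp: cochains_def length_Suc_conv)

lemma cochains_2I:
  assumes "\<And>xs. length xs \<noteq> 2 \<Longrightarrow> f xs = 0"
    and "\<And>y. Vector_Spaces.linear scaleG scaleV (\<lambda>x. f [x, y])"
    and "\<And>x. Vector_Spaces.linear scaleG scaleV (\<lambda>y. f [x, y])"
  shows "f \<in> cochains scaleG scaleV 2"
  using assms by (auto simp: cochains_def numeral_2_eq_2 length_Suc_conv less_Suc_eq)

text \<open>Each term of the differential applies one additive operation to the cochain, so
  additivity of the actions in their \<open>V\<close> argument and linearity of \<open>TV\<close>
  suffice.\<close>

lemma rbla_d_1_add:
  assumes "vector_space scaleV"
    and "\<And>x u v. l x (u + v) = l x u + l x v"
    and "\<And>u v x. r (u + v) x = r u x + r v x"
    and "Vector_Spaces.linear scaleV scaleV TV"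
  shows "rbla_d scaleV b T TV l r 1 (a + f, c + h) =
    rbla_d scaleV b T TV l r 1 (a, c) + rbla_d scaleV b T TV l r 1 (f, h)"
proof -
  interpret V: vector_space scaleV by fact
  have "rbo_coboundary scaleV b T TV l r 0 (c + h) =
      rbo_coboundary scaleV b T TV l r 0 c + rbo_coboundary scaleV b T TV l r 0 h"
    by (rule ext) (simp add: rbo_coboundary_def leibniz_coboundary_def r_prime_def assms
        linear_addD[OF assms(4)] algebra_simps)
  moreover have "leibniz_coboundary scaleV b l r 1 (a + f) =
      leibniz_coboundary scaleV b l r 1 a + leibniz_coboundary scaleV b l r 1 f"
    by (rule ext) (simp add: leibniz_coboundary_1[OF assms(1)] assms algebra_simps del: One_nat_def)
  moreover have "phi T TV 1 (a + f) = phi T TV 1 a + phi T TV 1 f"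
    by (rule ext) (simp add: phi_def linear_addD[OF assms(4)] algebra_simps)
  ultimately show ?thesis
    by (simp add: rbla_d_def algebra_simps)
qed

text \<open>The image of the additive map \<open>?d\<close> on the group \<open>?C\<close> is a
  group: a shift by \<open>?d w\<close> is absorbed by passing from \<open>v\<close> to
  \<open>w + v\<close>, and undone by passing to \<open>v - w\<close>.\<close>

lemma class_RBLA_add_coboundary:
  assumes "vector_space scaleV"
    and l: "\<And>x u v. l x (u + v) = l x u + l x v"
    and r: "\<And>u v x. r (u + v) x = r u x + r v x"
    and TV: "Vector_Spaces.linear scaleV scaleV TV"
    and w: "w \<in> rbla_cochains scaleG scaleV 1"
  shows "class_RBLA scaleG b T scaleV TV l r (z + rbla_d scaleV b T TV l r 1 w) =
    class_RBLA scaleG b T scaleV TV l r z"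
proof -
  interpret V: vector_space scaleV by fact
  let ?d = "rbla_d scaleV b T TV l r 1" and ?C = "rbla_cochains scaleG scaleV 1"
  have d_add: "?d (u + v) = ?d u + ?d v" for u v
    using rbla_d_1_add[where l = l and r = r, OF assms(1) l r TV]
    by (cases u, cases v) (simp del: One_nat_def)
  have add: "u + v \<in> ?C" and diff: "u - v \<in> ?C" if "u \<in> ?C" "v \<in> ?C" for u v
    using that
    by (auto simp: rbla_cochains_def cochains_def Vector_Spaces.linear_iff
        V.scale_right_distrib V.scale_right_diff_distrib)
  have d_diff: "?d (u - v) = ?d u - ?d v" for u v
    using d_add[of "u - v" v] by simp
  have "z + ?d w + ?d v \<in> z +o ?d ` ?C" if "v \<in> ?C" for v
    using add[OF w that] d_add[of w v] by (force simp: elt_set_plus_def add.assoc)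
  moreover have "z + ?d v \<in> (z + ?d w) +o ?d ` ?C" if "v \<in> ?C" for v
    using diff[OF that w] d_diff[of v w] by (force simp: elt_set_plus_def add.assoc)
  ultimately show ?thesis
    unfolding class_RBLA_def B2_RBLA_def by (auto simp: elt_set_plus_def)
qed

section \<open>An extension with a chosen section, and computation in \<open>V\<close> through
  \<open>i\<close>\<close>

locale sectioned_extension =
  abelian_extension scaleG bracketG TG scaleV TV scaleE bracketE TE i p
  for scaleG :: "'k::field \<Rightarrow> 'g::ab_group_add \<Rightarrow> 'g" and bracketG TG
    and scaleV :: "'k \<Rightarrow> 'v::ab_group_add \<Rightarrow> 'v" and TV
    and scaleE :: "'k \<Rightarrow> 'e::ab_group_add \<Rightarrow> 'e" and bracketE TE i p +
  fixes s :: "'g \<Rightarrow> 'e"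
  assumes s_section: "is_section scaleG scaleE p s"
begin

abbreviation "l \<equiv> ext_l i bracketE s"
abbreviation "r \<equiv> ext_r i bracketE s"
abbreviation "\<psi> \<equiv> ext_psi bracketG i bracketE s"
abbreviation "\<chi> \<equiv> ext_chi TG i TE s"

lemma s_linear: "Vector_Spaces.linear scaleG scaleE s"
  and p_s [simp]: "p (s x) = x"
  using s_section by (auto simp: is_section_def fun_eq_iff)

lemma p_i [simp]: "p (i u) = 0"
  using exact_middle by auto

text \<open>Exactness in the middle makes \<open>inv i\<close> a right inverse of \<open>i\<close>
  on the kernel of \<open>p\<close>, so each use of \<open>inv i\<close> rests on a computation with
  \<open>p\<close>.\<close>

lemma i_inv_i: "p e = 0 \<Longrightarrow> i (inv i e) = e"
  using exact_middle by (metis (mono_tags, lifting) f_inv_into_f mem_Collect_eq)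

lemma i_eq_iff: "i u = i v \<longleftrightarrow> u = v"
  using exact_left by (auto dest: injD)

lemmas p_simps [simp] =
  linear_addD[OF proj.hom_linear] linear_diffD[OF proj.hom_linear]
  linear_zeroD[OF proj.hom_linear] linear_scaleD[OF proj.hom_linear] proj.hom_bracket

lemmas i_simps [simp] =
  linear_addD[OF incl.hom_linear] linear_diffD[OF incl.hom_linear]
  linear_zeroD[OF incl.hom_linear] linear_scaleD[OF incl.hom_linear]

lemmas s_simps [simp] =
  linear_addD[OF s_linear] linear_diffD[OF s_linear] linear_scaleD[OF s_linear]

lemmas bracketE_simps [simp] =
  linear_addD[OF incl.cod.bracket_linear_left] linear_diffD[OF incl.cod.bracket_linear_left]
  linear_zeroD[OF incl.cod.bracket_linear_left] linear_scaleD[OF incl.cod.bracket_linear_left]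
  linear_addD[OF incl.cod.bracket_linear_right] linear_diffD[OF incl.cod.bracket_linear_right]
  linear_zeroD[OF incl.cod.bracket_linear_right] linear_scaleD[OF incl.cod.bracket_linear_right]

lemmas bracketG_simps [simp] =
  linear_addD[OF proj.cod.bracket_linear_left] linear_scaleD[OF proj.cod.bracket_linear_left]
  linear_zeroD[OF proj.cod.bracket_linear_left]
  linear_addD[OF proj.cod.bracket_linear_right] linear_scaleD[OF proj.cod.bracket_linear_right]
  linear_zeroD[OF proj.cod.bracket_linear_right]

lemmas T_simps [simp] =
  linear_addD[OF incl.dom.T_linear] linear_diffD[OF incl.dom.T_linear]
  linear_addD[OF incl.cod.T_linear] linear_diffD[OF incl.cod.T_linear]
  linear_scaleD[OF incl.cod.T_linear]
  linear_addD[OF proj.cod.T_linear] linear_scaleD[OF proj.cod.T_linear]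

lemma bracketE_i_i [simp]: "bracketE (i u) (i v) = 0"
  using incl.hom_bracket[of u v] by simp

lemma i_TV [simp]: "i (TV u) = TE (i u)"
  using incl.hom_T by (simp add: fun_eq_iff)

lemma p_TE [simp]: "p (TE e) = TG (p e)"
  using proj.hom_T by (simp add: fun_eq_iff)

text \<open>Every argument of \<open>inv i\<close> here is killed by \<open>p\<close>. Since
  \<open>i\<close> is injective, identities in \<open>V\<close> can be checked after applying
  \<open>i\<close>; these rules then turn them into identities between brackets and
  \<open>TE\<close> in the extension.\<close>

lemma i_l [simp]: "i (l x u) = bracketE (s x) (i u)"
  and i_r [simp]: "i (r u x) = bracketE (i u) (s x)"
  and i_\<psi> [simp]: "i (\<psi> [x, y]) = bracketE (s x) (s y) - s (bracketG x y)"
  and i_\<chi> [simp]: "i (\<chi> [x]) = TE (s x) - s (TG x)"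
  by (simp_all add: ext_l_def ext_r_def ext_psi_def ext_chi_def i_inv_i)

lemma l_add: "l x (u + v) = l x u + l x v"
  and r_add: "r (u + v) x = r u x + r v x"
  by (simp_all flip: i_eq_iff)

lemma linear_to_V:
  assumes "\<And>x y. i (f (x + y)) = i (f x) + i (f y)"
    and "\<And>c x. i (f (scaleG c x)) = scaleE c (i (f x))"
  shows "Vector_Spaces.linear scaleG scaleV f"
  unfolding Vector_Spaces.linear_iff
  using assms proj.cod.vector_space_axioms incl.dom.vector_space_axioms
  by (simp flip: i_eq_iff)

section \<open>The cocycle conditions for the associated pair\<close>

lemma cocycle_cochains: "(\<psi>, \<chi>) \<in> rbla_cochains scaleG scaleV 2"
proof -
  have "\<psi> \<in> cochains scaleG scaleV 2"
    by (rule cochains_2I; (rule linear_to_V)?)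
      (simp_all add: incl.cod.scale_right_diff_distrib, simp add: ext_psi_def)
  moreover have "\<chi> \<in> cochains scaleG scaleV 1"
    unfolding cochains_1_iff
    by (intro conjI linear_to_V)
      (simp_all add: incl.cod.scale_right_diff_distrib, simp add: ext_chi_def)
  ultimately show ?thesis
    by (simp add: rbla_cochains_def)
qed

text \<open>After applying \<open>i\<close>, the triple brackets of \<open>s x\<close>,
  \<open>s y\<close>, \<open>s z\<close> cancel by the Leibniz identity of the extension, the values
  of \<open>s\<close> on triple brackets cancel by the image under \<open>s\<close> of the identity
  in \<open>g\<close>, and mixed terms such as the bracket of \<open>s x\<close> with
  \<open>s (bracketG y z)\<close> cancel in pairs.\<close>

lemma coboundary_\<psi>: "leibniz_coboundary scaleV bracketG l r 2 \<psi> = 0"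
proof
  fix xs :: "'g list"
  show "leibniz_coboundary scaleV bracketG l r 2 \<psi> xs = 0 xs"
  proof (cases "length xs = 3")
    case True
    then obtain x y z where xs: "xs = [x, y, z]"
      by (auto simp: numeral_3_eq_3 length_Suc_conv)
    have "i (leibniz_coboundary scaleV bracketG l r 2 \<psi> [x, y, z]) = 0"
      using incl.cod.leibniz[of "s x" "s y" "s z"]
        arg_cong[OF proj.cod.leibniz[of x y z], of s]
      by (simp add: leibniz_coboundary_2[OF incl.dom.vector_space_axioms])
    then show ?thesis
      unfolding xs by (simp flip: i_eq_iff)
  qed (simp add: leibniz_coboundary_def)
qed

text \<open>
  As \<open>s \<circ> T = TE \<circ> s - \<chi>\<close> and the bracket vanishes on \<open>V\<close>, the Rota-Baxter identity of \<open>TE\<close>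
  at \<open>s x\<close>, \<open>s y\<close> becomes the following equation.
\<close>

lemma coboundary_\<chi>:
  "- rbo_coboundary scaleV bracketG TG TV l r 1 \<chi> - phi TG TV 2 \<psi> = 0"
proof
  fix xs :: "'g list"
  show "(- rbo_coboundary scaleV bracketG TG TV l r 1 \<chi> - phi TG TV 2 \<psi>) xs = 0 xs"
  proof (cases "length xs = 2")
    case True
    then obtain x y where xs: "xs = [x, y]"
      by (auto simp: numeral_2_eq_2 length_Suc_conv)
    \<comment> \<open>The names hide these two values from \<open>i_\<chi>\<close>, which would undo
      the rewriting of \<open>TE (s x)\<close> into \<open>s (TG x) + i a\<close>. The value of
      \<open>\<chi>\<close> at the starred bracket stays exposed and is expanded.\<close>
    define a b where "a = \<chi> [x]" and "b = \<chi> [y]"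
    have a: "TE (s x) = s (TG x) + i a" and b: "TE (s y) = s (TG y) + i b"
      by (simp_all add: a_def b_def)
    have "i ((- rbo_coboundary scaleV bracketG TG TV l r 1 \<chi> - phi TG TV 2 \<psi>) [x, y]) = 0"
      using incl.cod.rota_baxter[of "s x" "s y"]
        arg_cong[OF proj.cod.rota_baxter[of x y], of s]
      by (simp add: rbo_coboundary_def leibniz_coboundary_1[OF incl.dom.vector_space_axioms]
          l_prime_def r_prime_def bracket_star_def phi_def numeral_2_eq_2 lessThan_Suc
          flip: a_def b_def del: One_nat_def)
       (simp add: a b algebra_simps)
    then show ?thesis
      unfolding xs by (simp flip: i_eq_iff)
  qed (simp add: rbo_coboundary_def leibniz_coboundary_def phi_def)
qed

lemma cocycle: "(\<psi>, \<chi>) \<in> Z2_RBLA scaleG bracketG TG scaleV TV l r"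
  using cocycle_cochains coboundary_\<psi> coboundary_\<chi>
  by (simp add: Z2_RBLA_def rbla_d_def zero_prod_def)

section \<open>Independence of the section within one extension\<close>

lemma change_of_section:
  assumes "is_section scaleG scaleE p s'"
  shows "ext_l i bracketE s' = l" and "ext_r i bracketE s' = r"
    and "ext_class scaleG bracketG TG scaleV TV bracketE TE i s' =
      ext_class scaleG bracketG TG scaleV TV bracketE TE i s"
proof -
  interpret other: sectioned_extension scaleG bracketG TG scaleV TV scaleE bracketE TE i p s'
    by unfold_locales (fact assms)
  \<comment> \<open>Both sections lift the identity of \<open>g\<close>, so their difference lies in
    the kernel of \<open>p\<close> and comes from \<open>V\<close>.\<close>
  define f where "f xs = (if length xs = 1 then inv i (s' (xs ! 0) - s (xs ! 0)) else 0)"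
    for xs
  have i_f: "i (f [x]) = s' x - s x" for x
    by (simp add: f_def i_inv_i)
  then have s': "s' x = s x + i (f [x])" for x
    by simp
  show l: "ext_l i bracketE s' = l" and r: "ext_r i bracketE s' = r"
    by (intro ext; simp add: s' flip: i_eq_iff)+
  have "f \<in> cochains scaleG scaleV 1"
    unfolding cochains_1_iff
    by (intro conjI linear_to_V)
      (simp_all add: i_f incl.cod.scale_right_diff_distrib, simp add: f_def)
  moreover have "0 \<in> cochains scaleG scaleV 0"
    by (simp add: cochains_def)
  ultimately have f: "(f, 0) \<in> rbla_cochains scaleG scaleV 1"
    by (simp add: rbla_cochains_def)
  \<comment> \<open>Expanding the bracket of \<open>s x + i (f [x])\<close> and
    \<open>s y + i (f [y])\<close>, the cross terms are the two actions on \<open>f\<close>, and the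
    term with both factors in \<open>i(V)\<close> is zero.\<close>
  have "other.\<psi> = \<psi> + leibniz_coboundary scaleV bracketG l r 1 f"
  proof
    fix xs :: "'g list"
    show "other.\<psi> xs = (\<psi> + leibniz_coboundary scaleV bracketG l r 1 f) xs"
    proof (cases "length xs = 2")
      case True
      then obtain x y where "xs = [x, y]"
        by (auto simp: numeral_2_eq_2 length_Suc_conv)
      then show ?thesis
        by (simp add: leibniz_coboundary_1[OF incl.dom.vector_space_axioms] s'
            flip: i_eq_iff del: One_nat_def)
    qed (simp add: ext_psi_def leibniz_coboundary_def)
  qed
  \<comment> \<open>The change is \<open>TV (f [x]) - f [TG x]\<close>, which is minus
    \<open>phi\<close> of \<open>f\<close>. The degree-0 coboundary of the zero cochain is an
    \<open>r_prime\<close> term at \<open>0\<close>, hence the need for \<open>r0\<close> and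
    \<open>TV0\<close>.\<close>
  moreover have "other.\<chi> = \<chi> + (- rbo_coboundary scaleV bracketG TG TV l r 0 0 - phi TG TV 1 f)"
  proof
    fix xs :: "'g list"
    have r0: "r 0 x = 0" for x
      using r_add[of 0 0 x] by simp
    have TV0: "TV 0 = 0"
      by (rule linear_zeroD[OF incl.dom.T_linear])
    show "other.\<chi> xs = (\<chi> + (- rbo_coboundary scaleV bracketG TG TV l r 0 0 - phi TG TV 1 f)) xs"
    proof (cases "length xs = 1")
      case True
      then obtain x where "xs = [x]"
        by (auto simp: length_Suc_conv)
      then show ?thesis
        by (simp add: rbo_coboundary_def leibniz_coboundary_def r_prime_def r0 TV0 phi_def s'
            flip: i_eq_iff)
    qed (simp add: ext_chi_def rbo_coboundary_def leibniz_coboundary_def phi_def)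
  qed
  ultimately have "(other.\<psi>, other.\<chi>) = (\<psi>, \<chi>) + rbla_d scaleV bracketG TG TV l r 1 (f, 0)"
    by (simp add: rbla_d_def)
  then show "ext_class scaleG bracketG TG scaleV TV bracketE TE i s' =
      ext_class scaleG bracketG TG scaleV TV bracketE TE i s"
    unfolding ext_class_def l r
    using class_RBLA_add_coboundary[where l = l and r = r, OF incl.dom.vector_space_axioms l_add r_add
        incl.dom.T_linear f]
    by simp
qed

end

section \<open>Transport of a section along an isomorphism of extensions\<close>

lemma transport_section:
  assumes "rb_leibniz_iso scale1 bracket1 T1 scale2 bracket2 T2 \<xi>"
    and i: "\<xi> \<circ> i1 = i2" and p: "p2 \<circ> \<xi> = p1" and s: "is_section scaleG scale1 p1 s"
  shows "is_section scaleG scale2 p2 (\<xi> \<circ> s)"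
    and "ext_l i2 bracket2 (\<xi> \<circ> s) = ext_l i1 bracket1 s"
    and "ext_r i2 bracket2 (\<xi> \<circ> s) = ext_r i1 bracket1 s"
    and "ext_psi bracketG i2 bracket2 (\<xi> \<circ> s) = ext_psi bracketG i1 bracket1 s"
    and "ext_chi T i2 T2 (\<xi> \<circ> s) = ext_chi T i1 T1 s"
proof -
  interpret rb_leibniz_hom scale1 bracket1 T1 scale2 bracket2 T2 \<xi>
    using assms(1) by (simp add: rb_leibniz_iso_def)
  have "bij \<xi>"
    using assms(1) by (simp add: rb_leibniz_iso_def)
  have diff: "\<xi> x - \<xi> y = \<xi> (x - y)" for x y
    by (simp add: linear_diffD[OF hom_linear])
  have T: "T2 (\<xi> x) = \<xi> (T1 x)" for x
    using hom_T by (simp add: fun_eq_iff)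
  have i': "i2 u = \<xi> (i1 u)" for u
    using i by auto
  \<comment> \<open>This holds even for \<open>e\<close> outside the range of \<open>i1\<close>: as
    \<open>\<xi>\<close> is injective, both sides choose from the same predicate on
    \<open>V\<close>.\<close>
  have inv: "inv i2 (\<xi> e) = inv i1 e" for e
    unfolding inv_def i' using bij_is_inj[OF \<open>bij \<xi>\<close>] by (simp add: inj_eq)
  show "is_section scaleG scale2 p2 (\<xi> \<circ> s)"
    using s p unfolding is_section_def
    by (metis comp_assoc Vector_Spaces.linear_compose hom_linear)
  show "ext_l i2 bracket2 (\<xi> \<circ> s) = ext_l i1 bracket1 s"
    "ext_r i2 bracket2 (\<xi> \<circ> s) = ext_r i1 bracket1 s"
    by (intro ext; simp add: ext_l_def ext_r_def i' inv flip: hom_bracket)+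
  show "ext_psi bracketG i2 bracket2 (\<xi> \<circ> s) = ext_psi bracketG i1 bracket1 s"
    by (rule ext) (simp add: ext_psi_def diff inv flip: hom_bracket)
  show "ext_chi T i2 T2 (\<xi> \<circ> s) = ext_chi T i1 T1 s"
    by (rule ext) (simp add: ext_chi_def T diff inv)
qed

text \<open>Equality of the actions comes with the conclusion because it makes the two classes
  cosets of the same coboundary group.\<close>

theorem theorem6p9:
  fixes scaleG :: "'k::field \<Rightarrow> 'g::ab_group_add \<Rightarrow> 'g"
    and bracketG :: "'g \<Rightarrow> 'g \<Rightarrow> 'g" and T :: "'g \<Rightarrow> 'g"
    and scaleV :: "'k \<Rightarrow> 'v::ab_group_add \<Rightarrow> 'v" and TV :: "'v \<Rightarrow> 'v"
    and scale1 :: "'k \<Rightarrow> 'e1::ab_group_add \<Rightarrow> 'e1"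
    and bracket1 :: "'e1 \<Rightarrow> 'e1 \<Rightarrow> 'e1" and T1 :: "'e1 \<Rightarrow> 'e1"
    and i1 :: "'v \<Rightarrow> 'e1" and p1 :: "'e1 \<Rightarrow> 'g" and s1 :: "'g \<Rightarrow> 'e1"
    and scale2 :: "'k \<Rightarrow> 'e2::ab_group_add \<Rightarrow> 'e2"
    and bracket2 :: "'e2 \<Rightarrow> 'e2 \<Rightarrow> 'e2" and T2 :: "'e2 \<Rightarrow> 'e2"
    and i2 :: "'v \<Rightarrow> 'e2" and p2 :: "'e2 \<Rightarrow> 'g" and s2 :: "'g \<Rightarrow> 'e2"
  assumes "rb_leibniz_algebra scaleG bracketG T"
    and "vector_space scaleV"
    and "Vector_Spaces.linear scaleV scaleV TV"
    and "abelian_extension scaleG bracketG T scaleV TV scale1 bracket1 T1 i1 p1"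
    and "abelian_extension scaleG bracketG T scaleV TV scale2 bracket2 T2 i2 p2"
    and "isomorphic_extensions scale1 bracket1 T1 i1 p1 scale2 bracket2 T2 i2 p2"
    and "is_section scaleG scale1 p1 s1"
    and "is_section scaleG scale2 p2 s2"
  shows "ext_l i1 bracket1 s1 = ext_l i2 bracket2 s2 \<and>
         ext_r i1 bracket1 s1 = ext_r i2 bracket2 s2 \<and>
         ext_class scaleG bracketG T scaleV TV bracket1 T1 i1 s1
             \<in> H2_RBLA scaleG bracketG T scaleV TV (ext_l i1 bracket1 s1) (ext_r i1 bracket1 s1) \<and>
         ext_class scaleG bracketG T scaleV TV bracket1 T1 i1 s1
             = ext_class scaleG bracketG T scaleV TV bracket2 T2 i2 s2"
proof -
  obtain \<xi> where \<xi>: "rb_leibniz_iso scale1 bracket1 T1 scale2 bracket2 T2 \<xi>"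
      "\<xi> \<circ> i1 = i2" "p2 \<circ> \<xi> = p1"
    using assms(6) by (auto simp: isomorphic_extensions_def)
  interpret E1: sectioned_extension scaleG bracketG T scaleV TV scale1 bracket1 T1 i1 p1 s1
    using assms(4,7) by (simp add: sectioned_extension_def sectioned_extension_axioms_def)
  interpret E2: sectioned_extension scaleG bracketG T scaleV TV scale2 bracket2 T2 i2 p2 s2
    using assms(5,8) by (simp add: sectioned_extension_def sectioned_extension_axioms_def)
  note transport = transport_section[OF \<xi> assms(7)]
  \<comment> \<open>Within the second extension, the transported section
    \<open>\<xi> \<circ> s1\<close> is compared with the given \<open>s2\<close>.\<close>
  note change = E2.change_of_section[OF transport(1)]
  have "ext_class scaleG bracketG T scaleV TV bracket1 T1 i1 s1 =
      ext_class scaleG bracketG T scaleV TV bracket2 T2 i2 (\<xi> \<circ> s1)"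
    by (simp add: ext_class_def transport(2-5))
  moreover have "ext_class scaleG bracketG T scaleV TV bracket1 T1 i1 s1
      \<in> H2_RBLA scaleG bracketG T scaleV TV E1.l E1.r"
    using E1.cocycle by (simp add: ext_class_def H2_RBLA_def)
  ultimately show ?thesis
    using change transport(2,3) by simp
qed

end
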